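(* If $G_1(z)$ is entry-wise analytic and satisfies $\mathrm{spr}(G_1(z))<r_2$ in a region $\Omega\subset\mathbb{C}$, then $\boldsymbol\varphi_2(G_1(z))$ and $\boldsymbol\varphi_2^{\hat C_2}(z,G_1(z))$ are also entry-wise analytic in the same region $\Omega$.
   Context: Let $\mathbb{H}=\{-1,0,1\}$, $\mathbb{H}_+=\{0,1\}$, $S_0=\{1,\dots,s_0\}$ finite. Let $A_{i,j}$ ($i,j\in\mathbb{H}$), $A^{(1)}_{i,j}$ ($i\in\mathbb{H},j\in\mathbb{H}_+$), $A^{(2)}_{i,j}$ ($i\in\mathbb{H}_+,j\in\mathbb{H}$), $A^{(0)}_{i,j}$ ($i,j\in\mathbb{H}_+$) be nonnegative $s_0\times s_0$ matrices such that each of $A_{*,*}=\sum A_{i,j}$, $\sum A^{(1)}_{i,j}$, $\sum A^{(2)}_{i,j}$, $\sum A^{(0)}_{i,j}$ is stochastic. The 2d-QBD process $\{\boldsymbol Y_n\}=\{(X_{1,n},X_{2,n},J_n)\}$ is the Markov chain on $\mathbb{Z}_+^2\times S_0$ whose transition block from $(x_1,x_2)$ to $(x_1+i,x_2+j)$ is $A_{i,j}$ if $x_1,x_2\ne0$, $A^{(1)}_{i,j}$ if $x_1\neq0,x_2=0$, $A^{(2)}_{i,j}$ if $x_1=0,x_2\ne0$, $A^{(0)}_{i,j}$ if $x_1=x_2=0$ (other blocks zero). Standing assumptions. (1) $\{\boldsymbol Y_n\}$ is irreducible and aperiodic. (2) The chains on $\mathbb{Z}^2\times S_0$ (blocks $A_{i,j}$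 everywhere), on $\mathbb{Z}\times\mathbb{Z}_+\times S_0$ (blocks $A_{i,j}$ if $x_2\ne0$, $A^{(1)}_{i,j}$ if $x_2=0$) and on $\mathbb{Z}_+\times\mathbb{Z}\times S_0$ (blocks $A_{i,j}$ if $x_1\neq0$, $A^{(2)}_{i,j}$ if $x_1=0$) are irreducible and aperiodic. (3) The rate matrices of $\{\boldsymbol Y_n\}$ viewed as a QBD process with level $X_{1,n}$ (resp. $X_{2,n}$) and countable phase $(X_{2,n},J_n)$ (resp. $(X_{1,n},J_n)$) are irreducible. (4) $\{\boldsymbol Y_n\}$ satisfies the following drift conditions, which make it positive recurrent. Let $A_{k,*}=\sum_lA_{k,l}$, $A_{*,k}=\sum_lA_{l,k}$, $A^{(1)}_{*,k}=\sum_lA^{(1)}_{l,k}$, $A^{(2)}_{k,*}=\sum_lA^{(2)}_{k,l}$, let $\boldsymbol\pi_{*,*}$ be the stationary distribution of $A_{*,*}$, and $a_1^{\{1,2\}}=\boldsymbol\pi_{*,*}(-A_{-1,*}+A_{1,*})\mathbf 1$, $a_2^{\{1,2\}}=\boldsymbol\pi_{*,*}(-A_{*,-1}+A_{*,1})\mathbf 1$. Let $(\boldsymbol\pi^{(1)}_{*,k})_{k\ge0}$ be the stationary distribution (existing iff $a_2^{\{1,2\}}<0$) of the block tridiagonal matrix with first block row $(A^{(1)}_{*,0},A^{(1)}_{*,1},O,\dots)$ and other rows with blocks $A_{*,-1},A_{*,0},A_{*,1}$, and $a_1^{\{1\}}=\boldsymbol\pi^{(1)}_{*,0}\sum_{j\in\mathbb{H}_+}(A^{(1)}_{1,j}-A^{(1)}_{-1,j})\mathbf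 1+\sum_{k\ge1}\boldsymbol\pi^{(1)}_{*,k}(A_{1,*}-A_{-1,*})\mathbf 1$; define $a_2^{\{2\}}$ symmetrically (exchanging the two coordinates). Then: $a^{\{1,2\}}_1$ or $a^{\{1,2\}}_2$ is negative; if both are negative, then $a^{\{1\}}_1<0$ and $a^{\{2\}}_2<0$; if $a^{\{1,2\}}_1>0,a^{\{1,2\}}_2<0$, then $a^{\{1\}}_1<0$; if $a^{\{1,2\}}_1<0,a^{\{1,2\}}_2>0$, then $a^{\{2\}}_2<0$. Let $\boldsymbol\nu=(\boldsymbol\nu_{k,l})_{(k,l)\in\mathbb{Z}_+^2}$, $\boldsymbol\nu_{k,l}=(\nu_{k,l,j})_{j\in S_0}$, be the stationary distribution of $\{\boldsymbol Y_n\}$. Let $\xi_2=-\lim_{n\to\infty}\frac1n\log\nu_{i,n,k}$ (the limit exists and does not depend on $i,k$) and $r_2=e^{\xi_2}$. The radius of convergence of $\boldsymbol\varphi_2(w)=\sum_{j=1}^\infty\boldsymbol\nu_{0,j}w^j$ is $r_2$. For a scalar $z$ and an $s_0\times s_0$ matrix $X$, $\boldsymbol\varphi_2(X)=\sum_{j=1}^\infty\boldsymbol\nu_{0,j}X^j$, $\ \boldsymbol\varphi_2^{\hat C_2}(z,X)=\sum_{j=1}^\infty\boldsymbol\nu_{0,j}\hat C_2(z,X)X^{j-1}$, $\ \hat C_2(z,X)=\sum_{j\in\mathbb{H}}A^{(2)}_{*,j}(z)X^{j+1}$, $\ A^{(2)}_{*,j}(z)=\sum_{i\in\mathbb{H}_+}A^{(2)}_{i,j}z^i$.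 The matrix function $G_1$: with $A_{*,j}(z)=\sum_{i\in\mathbb{H}}A_{i,j}z^i$, $G_1(z)=\sum_{n\ge1}\sum A_{*,i_1}(z)\cdots A_{*,i_n}(z)$, the inner sum being over $(i_1,\dots,i_n)\in\mathbb{H}^n$ with $\sum_{l=1}^ki_l\ge0$ for $1\le k\le n-1$ and $\sum_{l=1}^ni_l=-1$. This series converges absolutely for $\underline z_1^*\le|z|\le\bar z_1^*$, where $\log\underline z_1^*$ and $\log\bar z_1^*$ are the minimum and maximum of $s_1$ over $\{(s_1,s_2)\in\mathbb{R}^2:\mathrm{spr}(\sum_{i,j}A_{i,j}e^{is_1+js_2})\le1\}$; elsewhere $G_1$ denotes its analytic continuation, where it exists. $\mathrm{spr}$ is the spectral radius. *)

theory Defs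
  imports "HOL-Analysis.Analysis"
begin

text \<open>
  The finite phase set \<open>S\<^sub>0\<close> is a type \<open>'s\<close> of class \<^class>\<open>finite\<close>.  Block families are functions of
  two integer indices; only indices in \<open>HH\<close> (for \<open>{-1,0,1}\<close>) and \<open>HHp\<close> (for \<open>{0,1}\<close>) are ever used.
  On \<^typ>\<open>complex^'s^'s\<close> the operations \<open>*\<close> and \<open>^\<close> are componentwise, so matrix products are
  written \<open>**\<close>, row vector times matrix \<open>v*\<close>, and matrix powers \<open>matpow\<close>.
\<close>

type_synonym 's blocks = "int \<Rightarrow> int \<Rightarrow> real^'s^'s"

definition HH :: "int set" where "HH = {-1, 0, 1}"
definition HHp :: "int set" where "HHp = {0, 1}"

definition swap_blocks :: "'s::finite blocks \<Rightarrow> 's blocks" where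
  "swap_blocks M = (\<lambda>i j. M j i)"


section \<open>Matrices\<close>

definition nonneg_mat :: "real^'s::finite^'s \<Rightarrow> bool" where
  "nonneg_mat M \<longleftrightarrow> (\<forall>a b. 0 \<le> M $ a $ b)"

definition stochastic :: "real^'s::finite^'s \<Rightarrow> bool" where
  "stochastic M \<longleftrightarrow> nonneg_mat M \<and> (\<forall>a. (\<Sum>b\<in>UNIV. M $ a $ b) = 1)"

definition cmat :: "real^'s::finite^'s \<Rightarrow> complex^'s^'s" where
  "cmat M = (\<chi> a b. complex_of_real (M $ a $ b))"

primrec matpow :: "complex^'s::finite^'s \<Rightarrow> nat \<Rightarrow> complex^'s^'s" where
  "matpow X 0 = mat 1"
| "matpow X (Suc n) = matpow X n ** X"

definition eigenvals :: "complex^'s::finite^'s \<Rightarrow> complex set" where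
  "eigenvals X = {l. \<exists>v. v \<noteq> 0 \<and> X *v v = l *s v}"

definition spr :: "complex^'s::finite^'s \<Rightarrow> real" where
  "spr X = Max (cmod ` eigenvals X)"


section \<open>Nonnegative matrices with countable index type\<close>

text \<open>Values are taken in \<^typ>\<open>ennreal\<close>, so that all the sums exist.\<close>

primrec nnpow :: "('x \<Rightarrow> 'x \<Rightarrow> ennreal) \<Rightarrow> nat \<Rightarrow> 'x \<Rightarrow> 'x \<Rightarrow> ennreal" where
  "nnpow T 0 = (\<lambda>x y. if x = y then 1 else 0)"
| "nnpow T (Suc n) = (\<lambda>x y. \<Sum>\<^sub>\<infinity>u. nnpow T n x u * T u y)"

definition irreducible_nn :: "('x \<Rightarrow> 'x \<Rightarrow> ennreal) \<Rightarrow> bool" where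
  "irreducible_nn T \<longleftrightarrow> (\<forall>x y. \<exists>n\<ge>1. 0 < nnpow T n x y)"

definition aperiodic_nn :: "('x \<Rightarrow> 'x \<Rightarrow> ennreal) \<Rightarrow> bool" where
  "aperiodic_nn T \<longleftrightarrow> (\<forall>x. Gcd {n. n \<ge> 1 \<and> 0 < nnpow T n x x} = 1)"

definition irreducible_aperiodic :: "('x \<Rightarrow> 'x \<Rightarrow> real) \<Rightarrow> bool" where
  "irreducible_aperiodic P \<longleftrightarrow>
     irreducible_nn (\<lambda>x y. ennreal (P x y)) \<and> aperiodic_nn (\<lambda>x y. ennreal (P x y))"

definition stationary_dist :: "('x \<Rightarrow> 'x \<Rightarrow> real) \<Rightarrow> ('x \<Rightarrow> real) \<Rightarrow> bool" where
  "stationary_dist P p \<longleftrightarrow>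
     (\<forall>x. 0 \<le> p x) \<and> (p has_sum 1) UNIV \<and> (\<forall>y. ((\<lambda>x. p x * P x y) has_sum p y) UNIV)"


section \<open>The transition kernels\<close>

definition block :: "int set \<Rightarrow> int set \<Rightarrow> 's::finite blocks \<Rightarrow> int \<Rightarrow> int \<Rightarrow> real^'s^'s" where
  "block D E M i j = (if i \<in> D \<and> j \<in> E then M i j else 0)"

definition qbd_kernel :: "'s::finite blocks \<Rightarrow> 's blocks \<Rightarrow> 's blocks \<Rightarrow> 's blocks
    \<Rightarrow> nat \<times> nat \<times> 's \<Rightarrow> nat \<times> nat \<times> 's \<Rightarrow> real" where
  "qbd_kernel A A1 A2 A0 = (\<lambda>(x1, x2, a) (y1, y2, b).
     (let i = int y1 - int x1; j = int y2 - int x2 in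
      if x1 \<noteq> 0 \<and> x2 \<noteq> 0 then block HH HH A i j
      else if x1 \<noteq> 0 \<and> x2 = 0 then block HH HHp A1 i j
      else if x1 = 0 \<and> x2 \<noteq> 0 then block HHp HH A2 i j
      else block HHp HHp A0 i j) $ a $ b)"

definition plane_kernel :: "'s::finite blocks \<Rightarrow> int \<times> int \<times> 's \<Rightarrow> int \<times> int \<times> 's \<Rightarrow> real" where
  "plane_kernel A = (\<lambda>(x1, x2, a) (y1, y2, b). block HH HH A (y1 - x1) (y2 - x2) $ a $ b)"

definition half_plane_kernel1 :: "'s::finite blocks \<Rightarrow> 's blocks
    \<Rightarrow> int \<times> nat \<times> 's \<Rightarrow> int \<times> nat \<times> 's \<Rightarrow> real" where
  "half_plane_kernel1 A A1 = (\<lambda>(x1, x2, a) (y1, y2, b).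
     (let i = y1 - x1; j = int y2 - int x2 in
      if x2 \<noteq> 0 then block HH HH A i j else block HH HHp A1 i j) $ a $ b)"

definition half_plane_kernel2 :: "'s::finite blocks \<Rightarrow> 's blocks
    \<Rightarrow> nat \<times> int \<times> 's \<Rightarrow> nat \<times> int \<times> 's \<Rightarrow> real" where
  "half_plane_kernel2 A A2 = (\<lambda>(x1, x2, a) (y1, y2, b).
     (let i = int y1 - int x1; j = y2 - x2 in
      if x1 \<noteq> 0 then block HH HH A i j else block HHp HH A2 i j) $ a $ b)"


section \<open>Rate matrices\<close>

text \<open>
  \<open>phase_block A A1 i\<close> is the block, indexed by the countable phase \<open>(x\<^sub>2, j)\<close>, of the transitions
  that change the level \<open>x\<^sub>1\<close> by \<open>i\<close>, starting from a level \<open>x\<^sub>1 \<noteq> 0\<close>.  With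
  \<open>swap_blocks A\<close>, \<open>swap_blocks A2\<close> it is the corresponding block for the level \<open>x\<^sub>2\<close> and the phase
  \<open>(x\<^sub>1, j)\<close>.
\<close>

definition phase_block :: "'s::finite blocks \<Rightarrow> 's blocks \<Rightarrow> int \<Rightarrow> nat \<times> 's \<Rightarrow> nat \<times> 's \<Rightarrow> real" where
  "phase_block A A1 i = (\<lambda>(x, a) (y, b).
     (let j = int y - int x in
      if x \<noteq> 0 then block HH HH A i j else block HH HHp A1 i j) $ a $ b)"

text \<open>
  The rate matrix is the minimal nonnegative solution \<open>R\<close> of
  \<open>R = U + R L + R\<^sup>2 D\<close>, where \<open>U, L, D\<close> are the upward, local and downward blocks.
\<close>

definition rate_matrix :: "('p \<Rightarrow> 'p \<Rightarrow> ennreal) \<Rightarrow> ('p \<Rightarrow> 'p \<Rightarrow> ennreal) \<Rightarrow> ('p \<Rightarrow> 'p \<Rightarrow> ennreal)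
    \<Rightarrow> 'p \<Rightarrow> 'p \<Rightarrow> ennreal" where
  "rate_matrix U L D = lfp (\<lambda>R x y. U x y + (\<Sum>\<^sub>\<infinity>u. R x u * L u y)
                                  + (\<Sum>\<^sub>\<infinity>u. (\<Sum>\<^sub>\<infinity>v. R x v * R v u) * D u y))"

definition qbd_rate_matrix :: "'s::finite blocks \<Rightarrow> 's blocks \<Rightarrow> nat \<times> 's \<Rightarrow> nat \<times> 's \<Rightarrow> ennreal" where
  "qbd_rate_matrix A A1 =
     rate_matrix (\<lambda>x y. ennreal (phase_block A A1 1 x y))
                 (\<lambda>x y. ennreal (phase_block A A1 0 x y))
                 (\<lambda>x y. ennreal (phase_block A A1 (-1) x y))"


section \<open>Mean drifts\<close>

text \<open>
  The stationary distributions below are unique whenever the chains on \<open>\<int>\<^sup>2 \<times> S\<^sub>0\<close>, respectively on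
  the half planes, are irreducible; the one in \<open>drift_axis\<close> exists iff the drift of the interior
  blocks towards the axis is negative.
  Drifts in the second coordinate are obtained by exchanging the coordinates with \<open>swap_blocks\<close>.
\<close>

definition drift_interior :: "'s::finite blocks \<Rightarrow> real" where
  "drift_interior A =
     (let p = (THE p. stationary_dist (\<lambda>a b. \<Sum>i\<in>HH. \<Sum>j\<in>HH. A i j $ a $ b) p) in
      \<Sum>a\<in>UNIV. p a * (\<Sum>b\<in>UNIV. \<Sum>l\<in>HH. (A 1 l $ a $ b - A (-1) l $ a $ b)))"

definition drift_axis :: "'s::finite blocks \<Rightarrow> 's blocks \<Rightarrow> real" where
  "drift_axis A A1 =
     (let p = (THE p. stationary_dist (\<lambda>x y. \<Sum>i\<in>HH. phase_block A A1 i x y) p) in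
      (\<Sum>a\<in>UNIV. p (0, a) * (\<Sum>b\<in>UNIV. \<Sum>j\<in>HHp. (A1 1 j $ a $ b - A1 (-1) j $ a $ b)))
      + (\<Sum>k. \<Sum>a\<in>UNIV. p (Suc k, a) * (\<Sum>b\<in>UNIV. \<Sum>l\<in>HH. (A 1 l $ a $ b - A (-1) l $ a $ b))))"

definition drift_conditions :: "'s::finite blocks \<Rightarrow> 's blocks \<Rightarrow> 's blocks \<Rightarrow> bool" where
  "drift_conditions A A1 A2 \<longleftrightarrow>
     (let a1 = drift_interior A; a2 = drift_interior (swap_blocks A);
          b1 = drift_axis A A1; b2 = drift_axis (swap_blocks A) (swap_blocks A2) in
      (a1 < 0 \<or> a2 < 0)
      \<and> (a1 < 0 \<and> a2 < 0 \<longrightarrow> b1 < 0 \<and> b2 < 0)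
      \<and> (a1 > 0 \<and> a2 < 0 \<longrightarrow> b1 < 0)
      \<and> (a1 < 0 \<and> a2 > 0 \<longrightarrow> b2 < 0))"


section \<open>The matrix function \<open>G\<^sub>1\<close>\<close>

definition A_star :: "'s::finite blocks \<Rightarrow> int \<Rightarrow> complex \<Rightarrow> complex^'s^'s" where
  "A_star A j z = (\<chi> a b. \<Sum>i\<in>HH. complex_of_real (A i j $ a $ b) * z powi i)"

definition G1_paths :: "nat \<Rightarrow> int list set" where
  "G1_paths n = {is. length is = n \<and> set is \<subseteq> HH
                   \<and> (\<forall>k\<in>{1..n - 1}. 0 \<le> sum_list (take k is)) \<and> sum_list is = -1}"

definition G1_series :: "'s::finite blocks \<Rightarrow> complex \<Rightarrow> complex^'s^'s" where
  "G1_series A z =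
     (\<Sum>n. \<Sum>is\<in>G1_paths (Suc n). foldr (\<lambda>j M. A_star A j z ** M) is (mat 1))"

definition Gamma_s1 :: "'s::finite blocks \<Rightarrow> real set" where
  "Gamma_s1 A = {s1. \<exists>s2. spr (cmat (\<Sum>i\<in>HH. \<Sum>j\<in>HH.
                            exp (of_int i * s1 + of_int j * s2) *\<^sub>R A i j)) \<le> 1}"

definition z1_lower :: "'s::finite blocks \<Rightarrow> real" where
  "z1_lower A = exp (Inf (Gamma_s1 A))"

definition z1_upper :: "'s::finite blocks \<Rightarrow> real" where
  "z1_upper A = exp (Sup (Gamma_s1 A))"

definition entrywise_analytic_on :: "(complex \<Rightarrow> complex^'s::finite^'s) \<Rightarrow> complex set \<Rightarrow> bool" where
  "entrywise_analytic_on F D \<longleftrightarrow> (\<forall>a b. (\<lambda>z. F z $ a $ b) analytic_on D)"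

text \<open>
  Analytic continuation of a function element along finite chains of regions.  Consecutive
  elements are only required to agree on some nonempty open set, so every branch is covered.
\<close>

inductive continuation ::
  "(complex \<Rightarrow> complex^'s::finite^'s) \<Rightarrow> complex set \<Rightarrow> (complex \<Rightarrow> complex^'s^'s) \<Rightarrow> complex set \<Rightarrow> bool"
  for F0 D0 where
  start: "continuation F0 D0 F0 D0"
| step: "continuation F0 D0 F D \<Longrightarrow> open E \<Longrightarrow> connected E \<Longrightarrow> entrywise_analytic_on G E
    \<Longrightarrow> open W \<Longrightarrow> W \<noteq> {} \<Longrightarrow> W \<subseteq> D \<inter> E \<Longrightarrow> (\<forall>z\<in>W. F z = G z) \<Longrightarrow> continuation F0 D0 G E"

text \<open>
  \<open>is_G1_on A G \<Omega>\<close>: on the region \<open>\<Omega>\<close> the function \<open>G\<close> is \<open>G\<^sub>1\<close>, that is, the series at points of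
  the closed annulus and an analytic continuation of it elsewhere.
\<close>

definition is_G1_on :: "'s::finite blocks \<Rightarrow> (complex \<Rightarrow> complex^'s^'s) \<Rightarrow> complex set \<Rightarrow> bool" where
  "is_G1_on A G \<Omega> \<longleftrightarrow>
     (\<forall>z\<in>\<Omega>. z1_lower A \<le> cmod z \<and> cmod z \<le> z1_upper A \<longrightarrow> G z = G1_series A z)
     \<and> continuation (G1_series A) {z. z1_lower A < cmod z \<and> cmod z < z1_upper A} G \<Omega>"


section \<open>The generating functions \<open>\<phi>\<^sub>2\<close>\<close>

definition nu_row :: "(nat \<times> nat \<times> 's::finite \<Rightarrow> real) \<Rightarrow> nat \<Rightarrow> nat \<Rightarrow> complex^'s" where
  "nu_row nu k l = (\<chi> a. complex_of_real (nu (k, l, a)))"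

definition A2_star :: "'s::finite blocks \<Rightarrow> int \<Rightarrow> complex \<Rightarrow> complex^'s^'s" where
  "A2_star A2 j z = (\<chi> a b. \<Sum>i\<in>HHp. complex_of_real (A2 i j $ a $ b) * z powi i)"

definition C2_hat :: "'s::finite blocks \<Rightarrow> complex \<Rightarrow> complex^'s^'s \<Rightarrow> complex^'s^'s" where
  "C2_hat A2 z X = (\<Sum>j\<in>HH. A2_star A2 j z ** matpow X (nat (j + 1)))"

text \<open>The index \<open>j\<close> in the terms below stands for \<open>j + 1\<close> in \<open>\<Sum>\<^sub>j\<^sub>\<ge>\<^sub>1\<close>.\<close>

definition phi2_term :: "(nat \<times> nat \<times> 's::finite \<Rightarrow> real) \<Rightarrow> complex^'s^'s \<Rightarrow> nat \<Rightarrow> complex^'s" where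
  "phi2_term nu X j = nu_row nu 0 (Suc j) v* matpow X (Suc j)"

definition phi2 :: "(nat \<times> nat \<times> 's::finite \<Rightarrow> real) \<Rightarrow> complex^'s^'s \<Rightarrow> complex^'s" where
  "phi2 nu X = (\<Sum>j. phi2_term nu X j)"

definition phi2C_term :: "'s blocks \<Rightarrow> (nat \<times> nat \<times> 's::finite \<Rightarrow> real)
    \<Rightarrow> complex \<Rightarrow> complex^'s^'s \<Rightarrow> nat \<Rightarrow> complex^'s" where
  "phi2C_term A2 nu z X j = (nu_row nu 0 (Suc j) v* C2_hat A2 z X) v* matpow X j"

definition phi2C :: "'s blocks \<Rightarrow> (nat \<times> nat \<times> 's::finite \<Rightarrow> real)
    \<Rightarrow> complex \<Rightarrow> complex^'s^'s \<Rightarrow> complex^'s" where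
  "phi2C A2 nu z X = (\<Sum>j. phi2C_term A2 nu z X j)"

end

theory Submission
  imports Defs "HOL-Complex_Analysis.Complex_Analysis"
    "HOL-Computational_Algebra.Fundamental_Theorem_Algebra"
begin

unbundle no Formal_Power_Series.fps_syntax

text \<open>
  The limit defining \<open>\<xi>\<^sub>2\<close> gives \<open>\<nu>\<^sub>0\<^sub>,\<^sub>n = O(\<tau>\<^sup>-\<^sup>n)\<close> for every \<open>\<tau> < r\<^sub>2\<close>, and
  \<open>spr(X) < \<rho>\<close> implies \<open>X\<^sup>n = O(\<rho>\<^sup>n)\<close>.  Submultiplicativity of the norm makes the second bound
  uniform for \<open>X = G\<^sub>1(w)\<close> with \<open>w\<close> near a given point \<open>z\<close>.  Choosing
  \<open>spr(G\<^sub>1(z)) < \<rho> < \<tau> < r\<^sub>2\<close>, both series are dominated near \<open>z\<close> by a geometric series of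
  ratio \<open>\<rho>/\<tau>\<close>, so their sums are locally uniform limits of holomorphic functions.
\<close>

section \<open>Growth of the powers of a matrix\<close>

lemma matpow_add: "matpow X (m + n) = matpow X m ** matpow X n"
  by (induction n) (simp_all add: matrix_mul_assoc)

lemma norm_vector_smult: "norm (c *s v) = cmod c * norm v" for v :: "complex^'n"
proof -
  have "norm (c *s v) = L2_set (\<lambda>i. cmod c * cmod (v $ i)) UNIV"
    by (simp add: norm_vec_def norm_mult)
  also have "\<dots> = cmod c * norm v"
    by (simp add: norm_vec_def L2_set_left_distrib L2_set_right_distrib)
  finally show ?thesis .
qed

text \<open>The vector p(X) v by Horner's scheme. \<open>poly\<close> would use the componentwise
  product of matrices; acting on a vector also allows polynomials that annihilate only this one
  vector.\<close>

definition poly_apply :: "complex^'n::finite^'n \<Rightarrow> complex poly \<Rightarrow> complex^'n \<Rightarrow> complex^'n" where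
  "poly_apply X p v = fold_coeffs (\<lambda>a w. a *s v + X *v w) p 0"

lemma poly_apply_0 [simp]: "poly_apply X 0 v = 0"
  by (simp add: poly_apply_def)

text \<open>The case split isolates \<open>pCons 0 0 = 0\<close>, where the fold makes no step and
  both sides vanish.\<close>

lemma poly_apply_pCons: "poly_apply X (pCons a p) v = a *s v + X *v poly_apply X p v"
  by (cases "p = 0 \<and> a = 0") (auto simp: poly_apply_def)

lemma poly_apply_add: "poly_apply X (p + q) v = poly_apply X p v + poly_apply X q v"
proof (induction p q rule: poly_induct2)
  case (pCons a p b q)
  then show ?case
    by (simp add: poly_apply_pCons matrix_vector_right_distrib vector_sadd_rdistrib algebra_simps)
qed simp

lemma poly_apply_smult: "poly_apply X (smult c p) v = c *s poly_apply X p v"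
  by (induction p)
    (simp_all add: poly_apply_pCons vector_add_ldistrib vector_smult_assoc vector_scalar_commute)

lemma poly_apply_diff: "poly_apply X (p - q) v = poly_apply X p v - poly_apply X q v"
  using poly_apply_add[of X "p - q" q v] by simp

lemma poly_apply_sum: "poly_apply X (sum p I) v = (\<Sum>i\<in>I. poly_apply X (p i) v)"
  by (induction I rule: infinite_finite_induct) (simp_all add: poly_apply_add)

lemma poly_apply_monom: "poly_apply X (monom c n) v = c *s (matpow X n *v v)"
proof (induction n)
  case 0
  then show ?case
    by (simp add: monom_0 poly_apply_pCons)
next
  case (Suc n)
  have "X ** matpow X n = matpow X (Suc n)"
    using matpow_add[of X 1 n] by simp
  with Suc show ?case
    by (simp add: monom_Suc poly_apply_pCons vector_scalar_commute[symmetric] matrix_vector_mul_assoc)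
qed

lemma poly_apply_diff_arg: "poly_apply X p (v - w) = poly_apply X p v - poly_apply X p w"
  by (induction p)
    (simp_all add: poly_apply_pCons matrix_vector_mult_diff_distrib vector_ssub_ldistrib)

lemma poly_apply_smult_arg: "poly_apply X p (c *s v) = c *s poly_apply X p v"
  by (induction p)
    (simp_all add: poly_apply_pCons vector_scalar_commute vector_add_ldistrib vector_smult_assoc mult.commute)

lemma poly_apply_mult_vec: "poly_apply X p (X *v v) = X *v poly_apply X p v"
  by (induction p)
    (simp_all add: poly_apply_pCons vector_scalar_commute matrix_vector_right_distrib)

text \<open>If (x - c) q annihilates v, this makes q(X) v either zero or an eigenvector for
  c.\<close>

lemma poly_apply_linear_factor:
  "poly_apply X ([:- c, 1:] * q) v = X *v poly_apply X q v - c *s poly_apply X q v"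
  by (simp add: poly_apply_diff poly_apply_smult poly_apply_pCons)

lemma poly_apply_eigenvector:
  assumes "X *v v = l *s v"
  shows "poly_apply X p v = poly p l *s v"
  using assms
  by (induction p)
    (simp_all add: poly_apply_pCons vector_scalar_commute vector_smult_assoc
      vector_sadd_rdistrib mult.commute)

text \<open>Cayley-Hamilton without determinants: the powers of X lie in a finite-dimensional space,
  so they are linearly dependent. Linear dependence concerns sets, so coinciding powers are treated
  separately.\<close>

lemma annihilating_poly_exists:
  fixes X :: "complex^'n::finite^'n"
  obtains p where "p \<noteq> 0" "\<And>v. poly_apply X p v = 0"
proof (cases "inj (matpow X)")
  case False
  then obtain i j where ij: "i \<noteq> j" "matpow X i = matpow X j"
    by (auto simp: inj_on_def)
  show ?thesis
  proof
    have "coeff (monom 1 i - monom 1 j) i \<noteq> (0::complex)"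
      using ij by simp
    then show "monom 1 i - monom 1 j \<noteq> (0::complex poly)"
      by (metis coeff_0)
    show "poly_apply X (monom 1 i - monom 1 j) v = 0" for v
      using ij by (simp add: poly_apply_diff poly_apply_monom)
  qed
next
  case True
  \<comment> \<open>With d the real dimension, the d + 1 distinct powers up to exponent d are too
    many to be independent.\<close>
  define d where "d = DIM(complex^'n^'n)"
  have inj: "inj_on (matpow X) {..d}"
    using True by (rule inj_on_subset) simp
  have "dependent (matpow X ` {..d})"
    using independent_bound[of "matpow X ` {..d}"] card_image[OF inj] by (auto simp: d_def)
  then obtain u where u: "\<exists>M\<in>matpow X ` {..d}. u M \<noteq> (0::real)"
      "(\<Sum>M\<in>matpow X ` {..d}. u M *\<^sub>R M) = 0"
    by (auto simp: real_vector.dependent_finite)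
  define c where "c i = u (matpow X i)" for i
  obtain k where k: "k \<le> d" "c k \<noteq> 0"
    using u(1) by (auto simp: c_def)
  have c: "(\<Sum>i\<le>d. c i *\<^sub>R matpow X i) = 0"
    using u(2) by (simp add: sum.reindex[OF inj] c_def)
  define p where "p = (\<Sum>i\<le>d. monom (complex_of_real (c i)) i)"
  show ?thesis
  proof
    have "coeff p k = c k"
      using k by (simp add: p_def coeff_sum)
    with k show "p \<noteq> 0"
      by auto
    fix v
    \<comment> \<open>The dependence is over the reals, whereas \<open>poly_apply\<close> scales by
      complex numbers.\<close>
    have smult: "complex_of_real r *s w = r *\<^sub>R w" for r and w :: "complex^'n"
      unfolding vec_eq_iff vector_scalar_mult_def vector_scaleR_component vec_lambda_beta
      by (simp add: scaleR_conv_of_real)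
    have "poly_apply X p v = (\<Sum>i\<le>d. c i *\<^sub>R (matpow X i *v v))"
      by (simp add: p_def poly_apply_sum poly_apply_monom smult)
    also have "\<dots> = (\<Sum>i\<le>d. c i *\<^sub>R matpow X i) *v v"
    proof -
      have "r *\<^sub>R (Y *v v) = r *\<^sub>R Y *v v" for r and Y :: "complex^'n^'n"
        by (simp add: vec_eq_iff matrix_vector_mult_def scaleR_sum_right)
      then have "(\<Sum>i\<in>I. c i *\<^sub>R (matpow X i *v v)) = (\<Sum>i\<in>I. c i *\<^sub>R matpow X i) *v v" for I
        by (induction I rule: infinite_finite_induct)
          (simp_all add: matrix_vector_mult_add_rdistrib)
      then show ?thesis .
    qed
    finally show "poly_apply X p v = 0"
      by (simp add: c)
  qed
qed

text \<open>Every eigenvalue is a root of any polynomial that annihilates all vectors. Finiteness is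
  what makes the \<open>Max\<close> in \<open>spr\<close> an upper bound.\<close>

lemma finite_eigenvals: "finite (eigenvals X)"
proof -
  obtain p where p: "p \<noteq> 0" "\<And>v. poly_apply X p v = 0"
    using annihilating_poly_exists[of X] by blast
  have "eigenvals X \<subseteq> {l. poly p l = 0}"
    using p(2) poly_apply_eigenvector[of X _ _ p] by (fastforce simp: eigenvals_def vector_mul_eq_0)
  with poly_roots_finite[OF p(1)] show ?thesis
    by (rule rev_finite_subset)
qed

lemma cmod_eigenval_le_spr: "l \<in> eigenvals X \<Longrightarrow> cmod l \<le> spr X"
  unfolding spr_def by (rule Max_ge) (auto simp: finite_eigenvals)

text \<open>
  Induction on the degree of a polynomial annihilating \<open>v\<close>: a linear factor \<open>X - c\<close> can be cancelled
  if \<open>c\<close> is not an eigenvalue, and otherwise \<open>X\<^sup>n\<^sup>+\<^sup>1 v = c X\<^sup>n v + X\<^sup>n (X v - c v)\<close> with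
  \<open>\<bar>c\<bar> < \<rho>\<close>.
\<close>
lemma matpow_vector_bound:
  fixes X :: "complex^'n::finite^'n"
  assumes "p \<noteq> 0" "poly_apply X p v = 0" "spr X < \<rho>" "0 < \<rho>"
  shows "\<exists>C\<ge>0. \<forall>n. norm (matpow X n *v v) \<le> C * \<rho> ^ n"
  using assms
proof (induction "degree p" arbitrary: p v)
  case 0
  then obtain a where "p = [:a:]"
    by (metis degree_eq_zeroE)
  with 0 have "v = 0"
    by (simp add: poly_apply_pCons)
  then show ?case
    by (intro exI[of _ 0]) simp
next
  case (Suc d)
  then obtain c where "poly p c = 0"
    using fundamental_theorem_of_algebra_alt[of p] by fastforce
  then obtain q where q: "p = [:- c, 1:] * q"
    by (auto simp: poly_eq_0_iff_dvd)
  with Suc.prems have q0: "q \<noteq> 0"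
    by auto
  with Suc.hyps(2) q have deg: "d = degree q"
    using degree_mult_eq[of "[:- c, 1:]" q] q0 by (simp del: mult_pCons_left)
  have Xq: "X *v poly_apply X q v - c *s poly_apply X q v = 0"
    using Suc.prems q by (simp only: poly_apply_linear_factor)
  show ?case
  proof (cases "c \<in> eigenvals X")
    case False
    with Xq have "poly_apply X q v = 0"
      by (auto simp: eigenvals_def)
    with Suc.hyps(1)[OF deg q0] Suc.prems show ?thesis
      by blast
  next
    case True
    with Suc.prems have c: "cmod c < \<rho>"
      using cmod_eigenval_le_spr by fastforce
    define w where "w = X *v v - c *s v"
    \<comment> \<open>Since q(X) commutes with X - c, q(X) w = (X - c) q(X) v = 0, so the induction
      hypothesis covers w.\<close>
    have "poly_apply X q w = 0"
      using Xq by (simp add: w_def poly_apply_diff_arg poly_apply_mult_vec poly_apply_smult_arg)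
    then obtain C where C: "C \<ge> 0" "\<And>n. norm (matpow X n *v w) \<le> C * \<rho> ^ n"
      using Suc.hyps(1)[OF deg q0] Suc.prems by blast
    \<comment> \<open>Chosen so that \<bar>c\<bar> D + C \<le> \<rho> D, which closes the recursion,
      and so that D covers the exponent 0.\<close>
    define D where "D = max (norm v) (C / (\<rho> - cmod c))"
    have D: "C \<le> D * (\<rho> - cmod c)" "norm v \<le> D"
      using c by (auto simp: D_def max_def field_simps)
    have "norm (matpow X n *v v) \<le> D * \<rho> ^ n" for n
    proof (induction n)
      case 0
      then show ?case
        using D by simp
    next
      case (Suc n)
      have "matpow X (Suc n) *v v = matpow X n *v (c *s v + w)"
        by (simp add: w_def matrix_vector_mul_assoc)
      also have "\<dots> = c *s (matpow X n *v v) + matpow X n *v w"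
        by (simp add: matrix_vector_right_distrib vector_scalar_commute)
      finally have "norm (matpow X (Suc n) *v v) \<le> cmod c * (D * \<rho> ^ n) + C * \<rho> ^ n"
        using mult_left_mono[OF Suc, of "cmod c"]
        by (simp only: norm_vector_smult norm_ge_zero norm_triangle_mono C(2))
      also have "C * \<rho> ^ n \<le> D * (\<rho> - cmod c) * \<rho> ^ n"
        using D Suc.prems \<open>0 < \<rho>\<close> by (intro mult_right_mono) auto
      finally show ?case
        by (simp add: algebra_simps)
    qed
    moreover have "0 \<le> D"
      using D(2) norm_ge_zero[of v] by linarith
    ultimately show ?thesis
      by blast
  qed
qed

text \<open>Applying the vector bound to the unit vectors bounds the columns of the powers; the norm
  is at most the sum of the moduli of all entries.\<close>

lemma matpow_bound:
  fixes X :: "complex^'n::finite^'n"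
  assumes "spr X < \<rho>" "0 < \<rho>"
  obtains C where "C \<ge> 0" "\<And>n. norm (matpow X n) \<le> C * \<rho> ^ n"
proof -
  obtain p where p: "p \<noteq> 0" "\<And>v. poly_apply X p v = 0"
    using annihilating_poly_exists[of X] by blast
  have "\<forall>b. \<exists>C\<ge>0. \<forall>n. norm (matpow X n *v axis b 1) \<le> C * \<rho> ^ n"
    using matpow_vector_bound[OF p(1) p(2) assms] by blast
  then obtain C where C: "\<And>b. C b \<ge> 0" "\<And>b n. norm (matpow X n *v axis b 1) \<le> C b * \<rho> ^ n"
    by metis
  have entry: "cmod (matpow X n $ a $ b) \<le> C b * \<rho> ^ n" for a b n
  proof -
    have "matpow X n $ a $ b = (matpow X n *v axis b 1) $ a"
      by (simp add: matrix_vector_mult_def axis_def if_distrib cong: if_cong)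
    then show ?thesis
      using Finite_Cartesian_Product.norm_nth_le[of "matpow X n *v axis b 1" a] C(2)[of n b] by (metis order_trans)
  qed
  show ?thesis
  proof
    show "0 \<le> (\<Sum>a\<in>(UNIV::'n set). \<Sum>b\<in>UNIV. C b)"
      by (intro sum_nonneg C)
    show "norm (matpow X n) \<le> (\<Sum>a\<in>(UNIV::'n set). \<Sum>b\<in>UNIV. C b) * \<rho> ^ n" for n
    proof -
      have "norm (matpow X n) \<le> (\<Sum>a\<in>UNIV. norm (matpow X n $ a))"
        unfolding norm_vec_def by (rule L2_set_le_sum) simp
      also have "\<dots> \<le> (\<Sum>a\<in>UNIV. \<Sum>b\<in>UNIV. cmod (matpow X n $ a $ b))"
        unfolding norm_vec_def by (intro sum_mono L2_set_le_sum) simp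
      also have "\<dots> \<le> (\<Sum>a\<in>(UNIV::'n set). \<Sum>b\<in>UNIV. C b * \<rho> ^ n)"
        by (intro sum_mono entry)
      finally show ?thesis
        by (simp only: sum_distrib_right)
    qed
  qed
qed

section \<open>Bounds and continuity of matrix products\<close>

lemma matrix_mult_bound:
  obtains K where "K > 0"
    "\<And>(A :: complex^'n::finite^'n) (B :: complex^'n^'n). norm (A ** B) \<le> K * norm A * norm B"
proof -
  have "bilinear ((**) :: complex^'n^'n \<Rightarrow> complex^'n^'n \<Rightarrow> complex^'n^'n)"
    unfolding bilinear_def
    by (intro conjI allI linearI)
      (simp_all add: vec_eq_iff matrix_matrix_mult_def sum.distrib scaleR_sum_right distrib_left distrib_right)
  from bilinear_bounded_pos[OF this] show ?thesis
    using that by blast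
qed

lemma vector_matrix_mult_bound:
  obtains K where "K > 0"
    "\<And>(v :: complex^'n::finite) (B :: complex^'n^'n). norm (v v* B) \<le> K * norm v * norm B"
proof -
  have "bilinear ((v*) :: complex^'n \<Rightarrow> complex^'n^'n \<Rightarrow> complex^'n)"
    by (auto simp: bilinear_def linear_iff vec_eq_iff vector_matrix_mult_def algebra_simps sum.distrib
        scaleR_sum_right)
  from bilinear_bounded_pos[OF this] show ?thesis
    using that by blast
qed

lemma continuous_on_matrix_mult:
  fixes F G :: "'a::topological_space \<Rightarrow> complex^'n::finite^'n"
  assumes "continuous_on S F" "continuous_on S G"
  shows "continuous_on S (\<lambda>z. F z ** G z)"
proof -
  have "continuous_on S (\<lambda>z. \<Sum>k\<in>UNIV. F z $ a $ k * G z $ k $ b)" for a b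
    by (intro continuous_intros assms)
  then show ?thesis
    unfolding matrix_matrix_mult_def by (intro continuous_on_vec_lambda)
qed

lemma continuous_on_matpow: "continuous_on S F \<Longrightarrow> continuous_on S (\<lambda>z. matpow (F z) n)"
  by (induction n) (simp_all add: continuous_on_matrix_mult)

text \<open>
  A single power \<open>m\<close> with \<open>K \<parallel>X\<^sup>m\<parallel> < \<rho>\<^sup>m\<close>, for a constant \<open>K\<close> making \<open>K \<parallel>\<cdot>\<parallel>\<close>
  submultiplicative, controls all powers, and this strict inequality persists near a given point.
\<close>
lemma matpow_bound_locally_uniform:
  fixes F :: "'a::heine_borel \<Rightarrow> complex^'n::finite^'n"
  assumes "open S" "continuous_on S F" "z \<in> S" "spr (F z) < \<rho>" "0 < \<rho>"
  obtains d M where "0 < d" "cball z d \<subseteq> S" "\<And>w n. w \<in> cball z d \<Longrightarrow> norm (matpow (F w) n) \<le> M * \<rho> ^ n"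
proof -
  obtain K :: real where K: "K > 0" "\<And>(A :: complex^'n^'n) (B :: complex^'n^'n). norm (A ** B) \<le> K * norm A * norm B"
    using matrix_mult_bound by blast
  \<comment> \<open>The gap between \<sigma> and \<rho> lets a high power absorb the constants K and
    C; the maximum with 0 keeps \<sigma> positive.\<close>
  obtain \<sigma> where \<sigma>: "max 0 (spr (F z)) < \<sigma>" "\<sigma> < \<rho>"
    using assms dense[of "max 0 (spr (F z))" \<rho>] by auto
  obtain C where C: "C \<ge> 0" "\<And>n. norm (matpow (F z) n) \<le> C * \<sigma> ^ n"
    using \<sigma> matpow_bound[of "F z" \<sigma>] by auto
  have "(\<lambda>n. K * C * (\<sigma> / \<rho>) ^ n) \<longlonglongrightarrow> K * C * 0"
    using \<sigma> by (intro tendsto_mult_left LIMSEQ_realpow_zero) auto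
  then have "\<forall>\<^sub>F n in sequentially. K * C * (\<sigma> / \<rho>) ^ n < 1"
    by (rule order_tendstoD) simp
  \<comment> \<open>A positive exponent m guarantees n - m < n in the strong induction
    below.\<close>
  then have "\<forall>\<^sub>F n in sequentially. 0 < n \<and> K * C * (\<sigma> / \<rho>) ^ n < 1"
    by (intro eventually_conj eventually_gt_at_top)
  then obtain m where m: "m > 0" "K * C * (\<sigma> / \<rho>) ^ m < 1"
    using eventually_happens'[OF sequentially_bot] by blast
  have "K * norm (matpow (F z) m) \<le> K * C * \<sigma> ^ m"
    using C(2)[of m] K(1) by simp
  also have "\<dots> < \<rho> ^ m"
    using m(2) assms by (simp add: power_divide field_simps)
  finally have zm: "K * norm (matpow (F z) m) < \<rho> ^ m" .
  have cont: "continuous_on S (\<lambda>w. K * norm (matpow (F w) n))" for n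
    by (intro continuous_intros continuous_on_matpow assms)
  have "open (S \<inter> (\<lambda>w. K * norm (matpow (F w) m)) -` {..<\<rho> ^ m})"
    by (intro continuous_open_preimage cont assms open_lessThan)
  moreover have "z \<in> S \<inter> (\<lambda>w. K * norm (matpow (F w) m)) -` {..<\<rho> ^ m}"
    using zm \<open>z \<in> S\<close> by simp
  ultimately obtain d where "0 < d"
      and d: "cball z d \<subseteq> S \<inter> (\<lambda>w. K * norm (matpow (F w) m)) -` {..<\<rho> ^ m}"
    unfolding open_contains_cball by blast
  have dS: "cball z d \<subseteq> S"
    using d by blast
  have dm: "K * norm (matpow (F w) m) < \<rho> ^ m" if "w \<in> cball z d" for w
    using subsetD[OF d that] by simp
  \<comment> \<open>The powers below m are finitely many, so compactness of the ball gives one bound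
    M for all of them after scaling.\<close>
  have "continuous_on (cball z d) (\<lambda>w. \<Sum>n<m. K * norm (matpow (F w) n) / \<rho> ^ n)"
  proof (rule continuous_on_sum)
    show "continuous_on (cball z d) (\<lambda>w. K * norm (matpow (F w) n) / \<rho> ^ n)" for n
      unfolding divide_inverse
      by (rule continuous_on_mult_right, rule continuous_on_subset[OF cont dS])
  qed
  from compact_continuous_image[OF this compact_cball]
  have bdd: "bdd_above ((\<lambda>w. \<Sum>n<m. K * norm (matpow (F w) n) / \<rho> ^ n) ` cball z d)"
    by (intro bounded_imp_bdd_above compact_imp_bounded)
  define M where "M = (SUP w\<in>cball z d. \<Sum>n<m. K * norm (matpow (F w) n) / \<rho> ^ n)"
  have M: "(\<Sum>n<m. K * norm (matpow (F w) n) / \<rho> ^ n) \<le> M" if "w \<in> cball z d" for w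
    unfolding M_def by (rule cSUP_upper[OF that bdd])
  have bound: "K * norm (matpow (F w) n) \<le> M * \<rho> ^ n" if w: "w \<in> cball z d" for w n
  proof (induction n rule: less_induct)
    case (less n)
    show ?case
    proof (cases "n < m")
      case True
      have "K * norm (matpow (F w) n) / \<rho> ^ n \<le> (\<Sum>n<m. K * norm (matpow (F w) n) / \<rho> ^ n)"
        using K assms True
        by (intro member_le_sum[where f = "\<lambda>n. K * norm (matpow (F w) n) / \<rho> ^ n"]) auto
      also note M[OF w]
      finally show ?thesis
        using \<open>0 < \<rho>\<close> by (simp add: pos_divide_le_eq)
    next
      case False
      \<comment> \<open>For n \<ge> m, split off the m-th power: it contributes at most \<rho>^m, so
        the constant M does not grow.\<close>
      have wm: "K * norm (matpow (F w) m) \<le> \<rho> ^ m"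
        using dm[OF w] by simp
      have "norm (matpow (F w) n) \<le> K * norm (matpow (F w) m) * norm (matpow (F w) (n - m))"
        using K(2) matpow_add[of "F w" m "n - m"] False by (metis le_add_diff_inverse not_less)
      then have "K * norm (matpow (F w) n) \<le> (K * norm (matpow (F w) m)) * (K * norm (matpow (F w) (n - m)))"
        using K(1) by (simp add: mult.assoc mult.left_commute)
      also have "\<dots> \<le> \<rho> ^ m * (M * \<rho> ^ (n - m))"
        using K(1) \<open>0 < \<rho>\<close> m False by (intro mult_mono[OF wm less]) auto
      also have "\<dots> = M * \<rho> ^ n"
        using False by (simp add: power_add[symmetric] mult.left_commute)
      finally show ?thesis .
    qed
  qed
  show ?thesis
  proof
    show "0 < d" "cball z d \<subseteq> S"
      by fact+
    show "norm (matpow (F w) n) \<le> M / K * \<rho> ^ n" if "w \<in> cball z d" for w n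
      using bound[OF that, of n] K(1) by (simp add: field_simps)
  qed
qed


section \<open>Locally uniformly convergent series of vectors\<close>

text \<open>The Weierstrass M-test on small closed balls makes the partial sums of each component
  converge locally uniformly, which preserves holomorphy.\<close>

lemma holomorphic_suminf_vec:
  fixes f :: "nat \<Rightarrow> complex \<Rightarrow> complex^'n::finite"
  assumes "open S" and hol: "\<And>n k. (\<lambda>z. f n z $ k) holomorphic_on S"
    and dom: "\<And>z. z \<in> S \<Longrightarrow> \<exists>d M. 0 < d \<and> cball z d \<subseteq> S \<and> summable M \<and>
                (\<forall>w\<in>cball z d. \<forall>n. norm (f n w) \<le> M n)"
  shows "z \<in> S \<Longrightarrow> summable (\<lambda>n. f n z)"
    and "(\<lambda>z. (\<Sum>n. f n z) $ k) holomorphic_on S"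
proof -
  show summ: "summable (\<lambda>n. f n z)" if "z \<in> S" for z
  proof -
    from dom[OF that] obtain d M where M: "0 < d" "summable M" "\<forall>w\<in>cball z d. \<forall>n. norm (f n w) \<le> M n"
      by blast
    then have "norm (f n z) \<le> M n" for n
      using centre_in_cball[of z d] by (metis less_imp_le)
    with M(2) show ?thesis
      by (rule summable_comparison_test'[of M 0])
  qed
  have "(\<lambda>z. \<Sum>n. f n z $ k) holomorphic_on S"
  proof (rule holomorphic_uniform_sequence[OF \<open>open S\<close>])
    show "(\<lambda>z. \<Sum>i<n. f i z $ k) holomorphic_on S" for n
      by (intro holomorphic_intros hol)
    fix z assume "z \<in> S"
    from dom[OF this] obtain d M where d: "0 < d" "cball z d \<subseteq> S" "summable M"
        "\<forall>w\<in>cball z d. \<forall>n. norm (f n w) \<le> M n"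
      by blast
    then have "uniform_limit (cball z d) (\<lambda>n z. \<Sum>i<n. f i z $ k) (\<lambda>z. \<Sum>n. f n z $ k) sequentially"
      by (intro Weierstrass_m_test[of _ _ M]) (auto intro: order_trans[OF Finite_Cartesian_Product.norm_nth_le])
    with d show "\<exists>d>0. cball z d \<subseteq> S \<and>
        uniform_limit (cball z d) (\<lambda>n z. \<Sum>i<n. f i z $ k) (\<lambda>z. \<Sum>n. f n z $ k) sequentially"
      by blast
  qed
  moreover have "(\<Sum>n. f n z) $ k = (\<Sum>n. f n z $ k)" if "z \<in> S" for z
    using bounded_linear.suminf[OF bounded_linear_vec_nth summ[OF that]] .
  ultimately show "(\<lambda>z. (\<Sum>n. f n z) $ k) holomorphic_on S"
    by (simp cong: holomorphic_cong)
qed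

lemma holomorphic_matpow:
  assumes "\<And>a b. (\<lambda>z. F z $ a $ b) holomorphic_on S"
  shows "(\<lambda>z. matpow (F z) n $ a $ b) holomorphic_on S"
proof (induction n arbitrary: a b)
  case 0
  then show ?case
    by (simp add: mat_def)
next
  case (Suc n)
  then show ?case
    by (simp add: matrix_matrix_mult_def) (intro holomorphic_intros assms)
qed

section \<open>Geometric decay of the stationary probabilities\<close>

lemma exp_bound_of_log_limit:
  assumes nonneg: "\<And>n. 0 \<le> u n"
    and lim: "(\<lambda>n. - (1 / real n) * ln (u n)) \<longlonglongrightarrow> \<xi>"
    and "0 < \<rho>" "\<rho> < exp \<xi>"
  obtains C where "C \<ge> 0" "\<And>n. u n \<le> C * (1 / \<rho>) ^ n"
proof -
  have "ln \<rho> < \<xi>"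
    using assms by (metis exp_less_cancel_iff exp_ln)
  with lim have "\<forall>\<^sub>F n in sequentially. ln \<rho> < - (1 / real n) * ln (u n)"
    by (rule order_tendstoD)
  \<comment> \<open>Multiplying the logarithmic inequality by n requires n > 0, as
    \<open>1 / real 0\<close> is 0.\<close>
  with eventually_gt_at_top[of 0] have "\<forall>\<^sub>F n in sequentially. u n \<le> (1 / \<rho>) ^ n"
  proof eventually_elim
    case (elim n)
    show ?case
    proof (cases "u n = 0") \<comment> \<open>here \<open>ln 0 = 0\<close> says nothing about \<open>u n\<close>\<close>
      case True
      with \<open>0 < \<rho>\<close> show ?thesis
        by simp
    next
      case False
      with nonneg[of n] have "0 < u n"
        by simp
      moreover have "ln (u n) \<le> ln ((1 / \<rho>) ^ n)"
        using elim \<open>0 < \<rho>\<close> by (simp add: ln_realpow ln_div field_simps)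
      ultimately show ?thesis
        using \<open>0 < \<rho>\<close> by simp
    qed
  qed
  then obtain N where N: "\<And>n. n \<ge> N \<Longrightarrow> u n \<le> (1 / \<rho>) ^ n"
    by (auto simp: eventually_sequentially)
  \<comment> \<open>The summand 1 serves n \<ge> N; the sum serves the finitely many smaller
    indices.\<close>
  define C where "C = 1 + (\<Sum>n<N. u n * \<rho> ^ n)"
  have sum0: "0 \<le> (\<Sum>n<N. u n * \<rho> ^ n)"
    using nonneg \<open>0 < \<rho>\<close> by (intro sum_nonneg) simp
  show ?thesis
  proof
    show "C \<ge> 0"
      using sum0 by (simp add: C_def)
    show "u n \<le> C * (1 / \<rho>) ^ n" for n
    proof (cases "n < N")
      case True
      have "u n * \<rho> ^ n \<le> (\<Sum>n<N. u n * \<rho> ^ n)"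
        using True nonneg \<open>0 < \<rho>\<close> by (intro member_le_sum[where f = "\<lambda>n. u n * \<rho> ^ n"]) auto
      then have "u n * \<rho> ^ n \<le> C"
        by (simp add: C_def)
      then show ?thesis
        using \<open>0 < \<rho>\<close> by (simp add: field_simps power_divide)
    next
      case False
      then have "u n \<le> 1 * (1 / \<rho>) ^ n"
        using N by simp
      also have "\<dots> \<le> C * (1 / \<rho>) ^ n"
        using sum0 \<open>0 < \<rho>\<close> by (intro mult_right_mono) (auto simp: C_def)
      finally show ?thesis .
    qed
  qed
qed

text \<open>The constants depend on the phase; there are finitely many phases, so their sum bounds
  the whole row.\<close>

lemma nu_row_bound:
  fixes nu :: "nat \<times> nat \<times> 's::finite \<Rightarrow> real"
  assumes "\<And>x. 0 \<le> nu x" "\<And>k. (\<lambda>n. - (1 / real n) * ln (nu (i, n, k))) \<longlonglongrightarrow> \<xi>"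
    and "0 < \<rho>" "\<rho> < exp \<xi>"
  obtains C where "C \<ge> 0" "\<And>n. norm (nu_row nu i n) \<le> C * (1 / \<rho>) ^ n"
proof -
  have "\<forall>k. \<exists>C\<ge>0. \<forall>n. nu (i, n, k) \<le> C * (1 / \<rho>) ^ n"
    using exp_bound_of_log_limit[OF assms(1) assms(2) assms(3,4)] by metis
  then obtain C where C: "\<And>k. C k \<ge> 0" "\<And>k n. nu (i, n, k) \<le> C k * (1 / \<rho>) ^ n"
    by metis
  show ?thesis
  proof
    show "0 \<le> (\<Sum>k\<in>UNIV. C k)"
      by (intro sum_nonneg C)
    fix n
    have "norm (nu_row nu i n) \<le> (\<Sum>k\<in>UNIV. nu (i, n, k))"
      unfolding norm_vec_def nu_row_def using L2_set_le_sum[of UNIV "\<lambda>k. nu (i, n, k)"]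
      by (simp add: assms(1))
    also have "\<dots> \<le> (\<Sum>k\<in>UNIV. C k * (1 / \<rho>) ^ n)"
      by (intro sum_mono C)
    finally show "norm (nu_row nu i n) \<le> (\<Sum>k\<in>UNIV. C k) * (1 / \<rho>) ^ n"
      by (simp only: sum_distrib_right)
  qed
qed

section \<open>Power series in a holomorphic matrix function\<close>

text \<open>Taking \<open>F z\<close> or \<open>C2_hat A2 z (F z)\<close> for \<open>H z\<close> gives the two series of the theorem.\<close>
lemma holomorphic_matrix_power_series:
  fixes c :: "nat \<Rightarrow> complex^'n::finite" and F H :: "complex \<Rightarrow> complex^'n^'n"
  assumes "open S"
    and F: "\<And>a b. (\<lambda>z. F z $ a $ b) holomorphic_on S"
    and H: "\<And>a b. (\<lambda>z. H z $ a $ b) holomorphic_on S"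
    and spr: "\<And>z. z \<in> S \<Longrightarrow> spr (F z) < r" and "0 < r"
    and c: "\<And>\<rho>. 0 < \<rho> \<Longrightarrow> \<rho> < r \<Longrightarrow> \<exists>C\<ge>0. \<forall>n. norm (c n) \<le> C * (1 / \<rho>) ^ n"
  shows "z \<in> S \<Longrightarrow> summable (\<lambda>n. (c n v* H z) v* matpow (F z) n)"
    and "(\<lambda>z. (\<Sum>n. (c n v* H z) v* matpow (F z) n) $ k) holomorphic_on S"
proof -
  have cont: "continuous_on S M"
    if "\<And>a b. (\<lambda>z. M z $ a $ b) holomorphic_on S" for M :: "complex \<Rightarrow> complex^'n^'n"
  proof -
    have "continuous_on S (\<lambda>z. \<chi> a b. M z $ a $ b)"
      by (intro continuous_on_vec_lambda holomorphic_on_imp_continuous_on that)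
    then show ?thesis
      by simp
  qed
  obtain K where K: "K > 0" "\<And>(v :: complex^'n) (B :: complex^'n^'n). norm (v v* B) \<le> K * norm v * norm B"
    using vector_matrix_mult_bound by blast
  have hol: "(\<lambda>z. ((c n v* H z) v* matpow (F z) n) $ k) holomorphic_on S" for n k
    by (simp add: vector_matrix_mult_def) (intro holomorphic_intros holomorphic_matpow F H)
  have dom: "\<exists>d M. 0 < d \<and> cball z d \<subseteq> S \<and> summable M \<and>
      (\<forall>w\<in>cball z d. \<forall>n. norm ((c n v* H w) v* matpow (F w) n) \<le> M n)" if z: "z \<in> S" for z
  proof -
    obtain \<rho> where \<rho>: "0 < \<rho>" "spr (F z) < \<rho>" "\<rho> < r"
      using dense[of "max 0 (spr (F z))" r] spr[OF z] \<open>0 < r\<close> by auto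
    obtain \<tau> where \<tau>: "\<rho> < \<tau>" "\<tau> < r"
      using dense \<rho>(3) by blast
    obtain C where C: "C \<ge> 0" "\<And>n. norm (c n) \<le> C * (1 / \<tau>) ^ n"
      using c[of \<tau>] \<rho> \<tau> by auto
    obtain d M where d: "0 < d" "cball z d \<subseteq> S"
        "\<And>w n. w \<in> cball z d \<Longrightarrow> norm (matpow (F w) n) \<le> M * \<rho> ^ n"
      using matpow_bound_locally_uniform[OF \<open>open S\<close> cont[OF F] z \<rho>(2,1)] by metis
    have "compact (H ` cball z d)"
      using d cont[OF H] by (intro compact_continuous_image compact_cball) (auto intro: continuous_on_subset)
    then obtain B where B: "B > 0" "\<And>w. w \<in> cball z d \<Longrightarrow> norm (H w) \<le> B"
      using compact_imp_bounded bounded_pos by (metis image_eqI)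
    show ?thesis
    proof (intro exI conjI ballI allI)
      \<comment> \<open>The majorant carries one factor K for each of the two vector-matrix
        products; C, B and M bound the coefficients, H and the powers of F.\<close>
      show "summable (\<lambda>n. (K * (K * C * B) * M) * (\<rho> / \<tau>) ^ n)"
        using \<rho> \<tau> by (intro summable_mult summable_geometric) auto
      fix w n assume w: "w \<in> cball z d"
      have pos: "0 \<le> K * (C * (1 / \<tau>) ^ n)"
        using K(1) C(1) \<rho>(1) \<tau>(1) by simp
      have cH: "norm (c n v* H w) \<le> K * (C * (1 / \<tau>) ^ n) * B"
        using K(1) pos
        by (intro order_trans[OF K(2)] mult_mono[OF mult_left_mono[OF C(2)] B(2)[OF w]]) auto
      have "norm ((c n v* H w) v* matpow (F w) n) \<le> K * (K * (C * (1 / \<tau>) ^ n) * B) * (M * \<rho> ^ n)"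
        using K(1) pos B(1)
        by (intro order_trans[OF K(2)] mult_mono[OF mult_left_mono[OF cH] d(3)[OF w]]) auto
      also have "\<dots> = (K * (K * C * B) * M) * (\<rho> / \<tau>) ^ n"
        by (simp add: power_divide)
      finally show "norm ((c n v* H w) v* matpow (F w) n) \<le> (K * (K * C * B) * M) * (\<rho> / \<tau>) ^ n" .
    qed (use d in auto)
  qed
  show "z \<in> S \<Longrightarrow> summable (\<lambda>n. (c n v* H z) v* matpow (F z) n)"
    using holomorphic_suminf_vec(1)[OF \<open>open S\<close> hol dom] .
  show "(\<lambda>z. (\<Sum>n. (c n v* H z) v* matpow (F z) n) $ k) holomorphic_on S"
    using holomorphic_suminf_vec(2)[OF \<open>open S\<close> hol dom] .
qed

text \<open>The entries are polynomials in z and the entries of F z: the exponents of z are only 0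
  and 1, so z = 0 causes no pole.\<close>

lemma holomorphic_C2_hat:
  assumes "\<And>a b. (\<lambda>z. F z $ a $ b) holomorphic_on S"
  shows "(\<lambda>z. C2_hat A2 z (F z) $ a $ b) holomorphic_on S"
proof -
  have "(\<lambda>z. A2_star A2 j z $ a $ b) holomorphic_on S" for j a b
    by (simp add: A2_star_def HHp_def) (intro holomorphic_intros)
  then have "(\<lambda>z. (A2_star A2 j z ** matpow (F z) n) $ a $ b) holomorphic_on S" for j n a b
    by (simp add: matrix_matrix_mult_def) (intro holomorphic_intros holomorphic_matpow assms)
  then show ?thesis
    by (simp only: C2_hat_def sum_component) (intro holomorphic_intros)
qed

theorem proposition5p1:
  fixes A A1 A2 A0 :: "'s::finite blocks"
    and nu :: "nat \<times> nat \<times> 's \<Rightarrow> real"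
    and xi2 r2 :: real
    and G1 :: "complex \<Rightarrow> complex^'s^'s"
    and \<Omega> :: "complex set"
  assumes "\<forall>i\<in>HH. \<forall>j\<in>HH. nonneg_mat (A i j)"
    and "\<forall>i\<in>HH. \<forall>j\<in>HHp. nonneg_mat (A1 i j)"
    and "\<forall>i\<in>HHp. \<forall>j\<in>HH. nonneg_mat (A2 i j)"
    and "\<forall>i\<in>HHp. \<forall>j\<in>HHp. nonneg_mat (A0 i j)"
    and "stochastic (\<Sum>i\<in>HH. \<Sum>j\<in>HH. A i j)"
    and "stochastic (\<Sum>i\<in>HH. \<Sum>j\<in>HHp. A1 i j)"
    and "stochastic (\<Sum>i\<in>HHp. \<Sum>j\<in>HH. A2 i j)"
    and "stochastic (\<Sum>i\<in>HHp. \<Sum>j\<in>HHp. A0 i j)"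
    and "irreducible_aperiodic (qbd_kernel A A1 A2 A0)"
    and "irreducible_aperiodic (plane_kernel A)"
    and "irreducible_aperiodic (half_plane_kernel1 A A1)"
    and "irreducible_aperiodic (half_plane_kernel2 A A2)"
    and "irreducible_nn (qbd_rate_matrix A A1)"
    and "irreducible_nn (qbd_rate_matrix (swap_blocks A) (swap_blocks A2))"
    and "drift_conditions A A1 A2"
    and "stationary_dist (qbd_kernel A A1 A2 A0) nu"
    and "\<forall>i k. (\<lambda>n. - (1 / real n) * ln (nu (i, n, k))) \<longlonglongrightarrow> xi2"
    and "r2 = exp xi2"
    and "open \<Omega>" and "connected \<Omega>"
    and "is_G1_on A G1 \<Omega>"
    and "entrywise_analytic_on G1 \<Omega>"
    and "\<forall>z\<in>\<Omega>. spr (G1 z) < r2"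
  shows "(\<forall>z\<in>\<Omega>. summable (phi2_term nu (G1 z)) \<and> summable (phi2C_term A2 nu z (G1 z)))
       \<and> (\<forall>k. (\<lambda>z. phi2 nu (G1 z) $ k) analytic_on \<Omega>)
       \<and> (\<forall>k. (\<lambda>z. phi2C A2 nu z (G1 z) $ k) analytic_on \<Omega>)"
proof -
  have G: "(\<lambda>z. G1 z $ a $ b) holomorphic_on \<Omega>" for a b
    using assms by (simp add: entrywise_analytic_on_def analytic_on_open)
  have spr: "spr (G1 z) < r2" if "z \<in> \<Omega>" for z
    using assms that by blast
  have r2: "0 < r2"
    using assms by simp
  have nonneg: "0 \<le> nu x" for x
    using \<open>stationary_dist _ nu\<close> unfolding stationary_dist_def by blast
  have lim: "(\<lambda>n. - (1 / real n) * ln (nu (0, n, k))) \<longlonglongrightarrow> xi2" for k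
    using assms by blast
  have c: "\<exists>C\<ge>0. \<forall>n. norm (nu_row nu 0 (Suc n)) \<le> C * (1 / \<rho>) ^ n" if \<rho>: "0 < \<rho>" "\<rho> < r2" for \<rho>
  proof -
    have "\<rho> < exp xi2"
      using \<rho> assms by simp
    then obtain C where C: "C \<ge> 0" "\<And>n. norm (nu_row nu 0 n) \<le> C * (1 / \<rho>) ^ n"
      using nu_row_bound[OF nonneg lim \<rho>(1)] by metis
    \<comment> \<open>The shift of index from n + 1 to n costs one factor 1/\<rho>, absorbed into
      the constant.\<close>
    have "norm (nu_row nu 0 (Suc n)) \<le> (C / \<rho>) * (1 / \<rho>) ^ n" for n
      using C(2)[of "Suc n"] by simp
    then show ?thesis
      using C(1) \<rho> by (intro exI[of _ "C / \<rho>"]) auto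
  qed
  \<comment> \<open>Splitting one factor X off the left of the power gives both series the same
    shape.\<close>
  have phi2: "phi2_term nu X = (\<lambda>n. (nu_row nu 0 (Suc n) v* X) v* matpow X n)" for X :: "complex^'s^'s"
  proof
    show "phi2_term nu X n = (nu_row nu 0 (Suc n) v* X) v* matpow X n" for n
      using matpow_add[of X 1 n] by (simp add: phi2_term_def vector_matrix_mul_assoc)
  qed
  have phi2C: "phi2C_term A2 nu z X = (\<lambda>n. (nu_row nu 0 (Suc n) v* C2_hat A2 z X) v* matpow X n)"
    for z and X :: "complex^'s^'s"
    by (simp add: phi2C_term_def fun_eq_iff)
  \<comment> \<open>The holomorphy of the middle factor is left open, to be filled with
    \<open>G1\<close> or with \<open>C2_hat\<close> at \<open>G1\<close>.\<close>
  note series = holomorphic_matrix_power_series[where c = "\<lambda>n. nu_row nu 0 (Suc n)", OF \<open>open \<Omega>\<close> G _ spr r2 c]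
  show ?thesis
    unfolding analytic_on_open[OF \<open>open \<Omega>\<close>] phi2_def phi2C_def phi2 phi2C
    by (intro conjI ballI allI series(1)[OF G] series(1)[OF holomorphic_C2_hat[OF G]]
      series(2)[OF G] series(2)[OF holomorphic_C2_hat[OF G]])
qed

end
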